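(* Let $r\geq 2$ and $e>0$ be integers. There exists a constant $C\geq 0$ (depending only on $r$ and $e$) such that for every multicharge $\mathsf{s}\in\mathbb{Z}^r$ and every $r$-partition $\boldsymbol\lambda$ that is an $\mathsf{s}$-reduced $e$-multicore we have $$\mathsf{w}^{\mathsf{s}}(\boldsymbol\lambda)\leq C.$$
   Context: A partition is a finite non-increasing sequence $\lambda = (\lambda_1\geq\dots\geq\lambda_h>0)$ of positive integers (possibly empty), with Young diagram $\{(a,b): 1\le a\le h,\ 1\le b\le \lambda_a\}$. An $r$-partition is an $r$-tuple $\boldsymbol\lambda=(\lambda^{(1)},\dots,\lambda^{(r)})$ of partitions; its nodes are the triples $(a,b,j)$ with $(a,b)$ in the Young diagram of $\lambda^{(j)}$. For a multicharge $\mathsf{s}=(s_1,\dots,s_r)\in\mathbb{Z}^r$, the $\mathsf{s}$-residue of $(a,b,j)$ is $b-a+s_j \bmod e$, and $c_i^{\mathsf{s}}(\boldsymbol\lambda)$ is the number of nodes of $\mathsf{s}$-residue $i\in\mathbb{Z}/e\mathbb{Z}$. The $\mathsf{s}$-weight of $\boldsymbol\lambda$ is $$\mathsf{w}^{\mathsf{s}}(\boldsymbol\lambda):=\sum_{j=1}^r c^{\mathsf{s}}_{s_j}(\boldsymbol\lambda)-\tfrac12\sum_{i\in\mathbb{Z}/e\mathbb{Z}}\bigl(c^{\mathsf{s}}_i(\boldsymbol\lambda)-c^{\mathsf{s}}_{i+1}(\boldsymbol\lambda)\bigr)^2,$$ with indices read modulo $e$. $Q=\bigoplus_{i\in\mathbb{Z}/e\mathbb{Z}}\mathbb{Z}\alpha_i$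 is free abelian with basis $(\alpha_i)$; $\delta:=\sum_{i\in\mathbb{Z}/e\mathbb{Z}}\alpha_i$; $\alpha^{\mathsf{s}}(\boldsymbol\lambda):=\sum_i c_i^{\mathsf{s}}(\boldsymbol\lambda)\alpha_i$; $Q^{\mathsf{s}}:=\{\alpha^{\mathsf{s}}(\boldsymbol\lambda):\boldsymbol\lambda\text{ an }r\text{-partition}\}$. An element $\alpha\in Q$ is a core block (for $\mathsf{s}$) if $\alpha\in Q^{\mathsf{s}}$ and $\alpha-\delta\notin Q^{\mathsf{s}}$. An $r$-partition $\boldsymbol\lambda$ is an $\mathsf{s}$-reduced $e$-multicore if $\alpha^{\mathsf{s}}(\boldsymbol\lambda)$ is a core block. (Such a $\boldsymbol\lambda$ is automatically an $e$-multicore, i.e. each $\lambda^{(j)}$ has no rim hook of length $e$.) *)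

theory Defs
  imports Complex_Main "HOL-Library.Poly_Mapping"
begin

definition is_partition :: "nat list \<Rightarrow> bool" where
  "is_partition p \<longleftrightarrow> sorted_wrt (\<ge>) p \<and> (\<forall>x\<in>set p. x > 0)"

definition is_multipartition :: "nat \<Rightarrow> nat list list \<Rightarrow> bool" where
  "is_multipartition r \<Lambda> \<longleftrightarrow> length \<Lambda> = r \<and> (\<forall>p\<in>set \<Lambda>. is_partition p)"

text \<open>Rows and columns are numbered from 1, list positions from 0.\<close>

definition young_diagram :: "nat list \<Rightarrow> (nat \<times> nat) set" where
  "young_diagram p = {(a, b). 1 \<le> a \<and> a \<le> length p \<and> 1 \<le> b \<and> b \<le> p ! (a - 1)}"

text \<open>A component index \<open>j\<close> runs over \<open>0, \<dots>, r - 1\<close>, both for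
  multipartitions and for multicharges.\<close>

definition nodes :: "nat list list \<Rightarrow> (nat \<times> nat \<times> nat) set" where
  "nodes \<Lambda> = {(a, b, j). j < length \<Lambda> \<and> (a, b) \<in> young_diagram (\<Lambda> ! j)}"

lemma finite_young_diagram: "finite (young_diagram p)"
proof (rule finite_subset)
  show "young_diagram p \<subseteq> (SIGMA a:{1..length p}. {1..p ! (a - 1)})"
    by (auto simp: young_diagram_def)
qed auto

lemma finite_nodes: "finite (nodes \<Lambda>)"
proof (rule finite_subset)
  show "nodes \<Lambda> \<subseteq>
      (\<lambda>(j, a, b). (a, b, j)) ` (SIGMA j:{..<length \<Lambda>}. young_diagram (\<Lambda> ! j))"
    by (force simp: nodes_def)
qed (auto simp: finite_young_diagram)

text \<open>Elements of \<open>\<int>/e\<int>\<close> are represented by integers: the canonical representatives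
  are \<open>{0..<e}\<close>, and \<open>res_count\<close> accepts any representative \<open>i\<close> of the class.\<close>

definition residue :: "nat \<Rightarrow> int list \<Rightarrow> nat \<times> nat \<times> nat \<Rightarrow> int" where
  "residue e s = (\<lambda>(a, b, j). (int b - int a + s ! j) mod int e)"

definition res_count :: "nat \<Rightarrow> int list \<Rightarrow> int \<Rightarrow> nat list list \<Rightarrow> nat" where
  "res_count e s i \<Lambda> = card {n \<in> nodes \<Lambda>. residue e s n = i mod int e}"

definition weight :: "nat \<Rightarrow> int list \<Rightarrow> nat list list \<Rightarrow> real" where
  "weight e s \<Lambda> =
     (\<Sum>j<length s. real (res_count e s (s ! j) \<Lambda>))
     - 1/2 * (\<Sum>i\<in>{0..<int e}. (real (res_count e s i \<Lambda>) - real (res_count e s (i + 1) \<Lambda>))\<^sup>2)"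

text \<open>The lattice \<open>Q\<close> consists of the \<open>x :: int \<Rightarrow>\<^sub>0 int\<close> with \<open>keys x \<subseteq> {0..<e}\<close>, the basis
  element \<open>\<alpha>\<^sub>i\<close> being \<open>frag_of i\<close>.\<close>

definition delta :: "nat \<Rightarrow> (int \<Rightarrow>\<^sub>0 int)" where
  "delta e = (\<Sum>i\<in>{0..<int e}. frag_of i)"

definition alpha :: "nat \<Rightarrow> int list \<Rightarrow> nat list list \<Rightarrow> (int \<Rightarrow>\<^sub>0 int)" where
  "alpha e s \<Lambda> = (\<Sum>i\<in>{0..<int e}. frag_cmul (int (res_count e s i \<Lambda>)) (frag_of i))"

definition Q_blocks :: "nat \<Rightarrow> int list \<Rightarrow> (int \<Rightarrow>\<^sub>0 int) set" where
  "Q_blocks e s = {alpha e s \<Lambda> |\<Lambda>. is_multipartition (length s) \<Lambda>}"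

definition is_core_block :: "nat \<Rightarrow> int list \<Rightarrow> (int \<Rightarrow>\<^sub>0 int) \<Rightarrow> bool" where
  "is_core_block e s \<beta> \<longleftrightarrow> \<beta> \<in> Q_blocks e s \<and> \<beta> - delta e \<notin> Q_blocks e s"

definition is_reduced_multicore :: "nat \<Rightarrow> int list \<Rightarrow> nat list list \<Rightarrow> bool" where
  "is_reduced_multicore e s \<Lambda> \<longleftrightarrow>
     is_multipartition (length s) \<Lambda> \<and> is_core_block e s (alpha e s \<Lambda>)"

end

theory Submission
  imports Defs
begin

text \<open>
  The bound comes from replacing partitions by integer vectors. Put the beta-numbers of a
  partition of charge \<open>s\<close> on an abacus with \<open>e\<close> runners, runner \<open>t\<close> holding the beads
  \<open>x \<equiv> t (mod e)\<close> at height \<open>x div e\<close>. Two data matter: the vector \<open>(z\<^sub>t)\<close> of the charges of the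
  runners, which has sum \<open>s\<close>, and the number \<open>W \<ge> 0\<close> of steps by which the beads exceed their
  lowest positions, which is the number of rim \<open>e\<close>-hooks to be removed before reaching the
  \<open>e\<close>-core. Every pair \<open>(z, W)\<close> of this kind occurs, and the residue counts depend on nothing
  else: with \<open>g\<close> the vector of the empty partition,
  \<open>2 c\<^sub>i = |z|\<^sup>2 - |g|\<^sup>2 - 2 \<Sum>\<^bsub>t<i\<^esub> (z\<^sub>t - g\<^sub>t) + 2 W\<close>
  (lemmas \<open>partition_charges\<close> and \<open>ex_partition_with_charges\<close>).

  A multipartition thus becomes an integer matrix \<open>(z\<^bsub>jt\<^esub>)\<close> with prescribed row sums \<open>s\<^sub>j\<close>, together
  with a total \<open>W\<close>. Its block is determined by the column sums and by \<open>|z|\<^sup>2 + 2 W\<close>, and subtracting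
  \<open>\<delta>\<close> keeps the column sums and lowers \<open>|z|\<^sup>2 + 2 W\<close> by \<open>2\<close>. So for a core block no matrix with the
  same margins can have a smaller norm. Changing four entries by \<open>\<plusminus>1\<close> in a two-by-two pattern keeps
  all margins, and minimality against such changes forces every alternating sum
  \<open>z\<^bsub>jt\<^esub> - z\<^bsub>kt\<^esub> - z\<^bsub>ju\<^esub> + z\<^bsub>ku\<^esub>\<close> to be at most \<open>2\<close> in absolute value
  (\<open>reduced_charges_minor_le\<close>): the difference of two rows is nearly constant.

  The weight only sees differences of rows (\<open>weight_charges\<close>): when \<open>W = 0\<close>, four times the weight is
  the sum over all pairs \<open>(j, k)\<close> of \<open>|z\<^sub>j - z\<^sub>k|\<^sup>2 - |g\<^sub>j - g\<^sub>k|\<^sup>2\<close>. Both vectors have the coordinate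
  sum \<open>s\<^sub>j - s\<^sub>k\<close>. Among vectors with that sum the constant one has the least norm, and a nearly
  constant one exceeds that norm by a bounded amount, whatever \<open>s\<close> is. Each pair contributes at most
  \<open>2 e\<close>, which bounds the weight by \<open>e r\<^sup>2 / 2\<close>.
\<close>

section \<open>Residue counts and beta-numbers\<close>

definition content_count :: "int \<Rightarrow> int \<Rightarrow> int \<Rightarrow> nat list \<Rightarrow> nat" where
  "content_count e s i p =
     card {(a, b) \<in> young_diagram p. (int b - int a + s) mod e = i mod e}"

text \<open>
  Here \<open>p\<close> may end in zeros, and each zero contributes one more bead. The usual set of beta-numbers
  is infinite downwards; adding zeros to \<open>p\<close> exposes as much of it as needed.
\<close>

definition beta :: "int \<Rightarrow> nat list \<Rightarrow> int set" where
  "beta s p = (\<lambda>a. int (p ! a) - int a - 1 + s) ` {..<length p}"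

lemma le_div_iff_mult_le:
  fixes e k n :: int
  assumes "e > 0"
  shows "k \<le> n div e \<longleftrightarrow> k * e \<le> n"
proof
  assume "k \<le> n div e"
  then have "k * e \<le> n div e * e" using assms by (intro mult_right_mono) auto
  also have "\<dots> \<le> n" using assms by (simp add: minus_mod_eq_div_mult[symmetric])
  finally show "k * e \<le> n" .
next
  assume "k * e \<le> n"
  then have "k * e div e \<le> n div e" using assms by (intro zdiv_mono1) auto
  then show "k \<le> n div e" using assms by simp
qed

lemma card_residue_class_interval:
  fixes e u v i :: int
  assumes "e > 0" and "u \<le> v"
  shows "int (card {y \<in> {u<..v}. y mod e = i mod e}) = (v - i) div e - (u - i) div e"
proof -
  have ivl: "u < i + e * k \<and> i + e * k \<le> v \<longleftrightarrow> (u - i) div e < k \<and> k \<le> (v - i) div e" for k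
  proof -
    have "k \<le> (v - i) div e \<longleftrightarrow> k * e \<le> v - i" "k \<le> (u - i) div e \<longleftrightarrow> k * e \<le> u - i"
      using assms(1) by (simp_all add: le_div_iff_mult_le)
    then show ?thesis by (simp only: mult.commute[of e k]) linarith
  qed
  have "{y \<in> {u<..v}. y mod e = i mod e} = (\<lambda>k. i + e * k) ` {(u - i) div e<..(v - i) div e}"
    (is "?A = ?B")
  proof (intro equalityI subsetI)
    fix y assume y: "y \<in> ?A"
    then have "e dvd y - i" by (simp add: mod_eq_dvd_iff)
    then obtain k where "y = i + e * k" by (auto simp: dvd_def algebra_simps)
    then show "y \<in> ?B" using y ivl[of k] by auto
  next
    fix y assume "y \<in> ?B"
    then obtain k where "y = i + e * k" "k \<in> {(u - i) div e<..(v - i) div e}" by blast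
    then show "y \<in> ?A" using ivl[of k] by simp
  qed
  moreover have "inj_on (\<lambda>k. i + e * k) X" for X using assms(1) by (auto simp: inj_on_def)
  moreover have "(u - i) div e \<le> (v - i) div e" using assms by (intro zdiv_mono1) auto
  ultimately show ?thesis by (simp add: card_image)
qed

text \<open>
  The nodes of one row have consecutive contents, so those of a given residue are counted by a
  difference of floors.
\<close>

lemma content_count_rows:
  assumes "e > 0"
  shows "int (content_count e s i p) =
    (\<Sum>a<length p. (int (p ! a) - int a - 1 + s - i) div e - (s - int a - 1 - i) div e)"
proof -
  let ?R = "\<lambda>a. {y \<in> {s - int a - 1<..int (p ! a) - int a - 1 + s}. y mod e = i mod e}"
  let ?N = "{(a, b) \<in> young_diagram p. (int b - int a + s) mod e = i mod e}"
  have bij: "bij_betw (\<lambda>(a, y). (Suc a, nat (y + int a + 1 - s))) (SIGMA a:{..<length p}. ?R a) ?N"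
  proof (rule bij_betw_byWitness[where f' = "\<lambda>(a, b). (a - 1, int b - int a + s)"])
    show "(\<lambda>(a, y). (Suc a, nat (y + int a + 1 - s))) ` (SIGMA a:{..<length p}. ?R a) \<subseteq> ?N"
      by (clarsimp simp: young_diagram_def) linarith
    show "(\<lambda>(a, b). (a - 1, int b - int a + s)) ` ?N \<subseteq> (SIGMA a:{..<length p}. ?R a)"
      by (clarsimp simp: young_diagram_def of_nat_diff) linarith
  qed (auto simp: young_diagram_def)
  have "content_count e s i p = card (SIGMA a:{..<length p}. ?R a)"
    unfolding content_count_def by (rule bij_betw_same_card[OF bij, symmetric])
  also have "\<dots> = (\<Sum>a<length p. card (?R a))"
  proof (rule card_SigmaI)
    show "\<forall>a\<in>{..<length p}. finite (?R a)"
      by (intro ballI finite_subset[OF Collect_restrict] finite_greaterThanAtMost_int)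
  qed simp
  finally have cells: "content_count e s i p = (\<Sum>a<length p. card (?R a))" .
  have row: "int (card (?R a)) =
      (int (p ! a) - int a - 1 + s - i) div e - (s - int a - 1 - i) div e" for a
    by (rule card_residue_class_interval[OF assms]) linarith
  show ?thesis by (simp only: cells of_nat_sum row)
qed

lemma inj_on_beta:
  assumes "sorted_wrt (\<ge>) p"
  shows "inj_on (\<lambda>a. int (p ! a) - int a - 1 + s) {..<length p}"
proof (rule linorder_inj_onI)
  fix a b assume "a < b" "a \<in> {..<length p}" "b \<in> {..<length p}"
  then have "p ! b \<le> p ! a" using sorted_wrt_nth_less[OF assms] by auto
  then show "int (p ! a) - int a - 1 + s \<noteq> int (p ! b) - int b - 1 + s"
    using \<open>a < b\<close> by linarith
qed auto

text \<open>The floors subtracted in each row are those of the beta-numbers of the empty partition.\<close>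

lemma content_count_beta:
  assumes "e > 0" and "sorted_wrt (\<ge>) p"
  shows "int (content_count e s i p) =
    (\<Sum>x\<in>beta s p. (x - i) div e) - (\<Sum>x\<in>{s - int (length p)..<s}. (x - i) div e)"
proof -
  have "(\<Sum>x\<in>beta s p. (x - i) div e) = (\<Sum>a<length p. (int (p ! a) - int a - 1 + s - i) div e)"
    unfolding beta_def by (subst sum.reindex[OF inj_on_beta[OF assms(2)]]) simp
  moreover have "(\<Sum>x\<in>{s - int (length p)..<s}. (x - i) div e) =
      (\<Sum>a<length p. (s - int a - 1 - i) div e)"
    by (rule sum.reindex_bij_witness[of _ "\<lambda>a. s - int a - 1" "\<lambda>x. nat (s - 1 - x)"]) auto
  ultimately show ?thesis
    by (simp add: content_count_rows[OF assms(1)] sum_subtractf)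
qed

lemma beta_Cons: "beta s (n # p) = insert (int n - 1 + s) (beta (s - 1) p)"
proof -
  have "beta s (n # p) = insert (int n - 1 + s)
      ((\<lambda>a. int ((n # p) ! Suc a) - int (Suc a) - 1 + s) ` {..<length p})"
    by (simp only: beta_def list.size(4) add_Suc_right add_0_right lessThan_Suc_eq_insert_0
        image_insert image_image nth_Cons_0) simp
  also have "(\<lambda>a. int ((n # p) ! Suc a) - int (Suc a) - 1 + s) ` {..<length p} = beta (s - 1) p"
    unfolding beta_def by (intro image_cong refl) simp
  finally show ?thesis .
qed

text \<open>
  Induction on the largest bead: it determines the first row, and the other beads are the
  beta-numbers of the remaining rows for the charge \<open>s - 1\<close>.
\<close>

lemma ex_beta_eq:
  assumes "finite X" and "X \<subseteq> {s - int (card X)..}"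
  shows "\<exists>p. sorted_wrt (\<ge>) p \<and> length p = card X \<and> beta s p = X"
  using assms
proof (induction X arbitrary: s rule: finite_linorder_max_induct)
  case empty
  show ?case by (simp add: beta_def)
next
  case (insert m X)
  have card: "card (insert m X) = Suc (card X)" using insert.hyps by auto
  have "X \<subseteq> {s - 1 - int (card X)..}" using insert.prems card by auto
  from insert.IH[OF this] obtain p
    where p: "sorted_wrt (\<ge>) p" "length p = card X" "beta (s - 1) p = X" by auto
  have "insert m X \<subseteq> {s - int (card (insert m X))..m}"
    using insert.hyps(2) insert.prems by force
  then have "card (insert m X) \<le> card {s - int (card (insert m X))..m}"
    by (rule card_mono[rotated]) simp
  \<comment> \<open>Distinct beads bounded below leave room for a first row of non-negative length.\<close>
  then have ge: "m + 1 - s \<ge> 0" using card by simp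
  define n where "n = nat (m + 1 - s)"
  have "y \<le> n" if "y \<in> set p" for y
  proof -
    have "p \<noteq> []" using that by auto
    then obtain y0 p' where p': "p = y0 # p'" by (cases p) auto
    then have "int y0 - 1 + (s - 1) \<in> beta (s - 1) p" by (simp add: beta_Cons)
    then have "int y0 - 1 + (s - 1) < m" using p(3) insert.hyps(2) by auto
    then have "y0 \<le> n" using n_def by linarith
    then show ?thesis using that p(1) p' by auto
  qed
  then have "sorted_wrt (\<ge>) (n # p)" using p(1) by auto
  moreover have "beta s (n # p) = insert m (beta (s - 1) p)"
    using ge by (simp add: beta_Cons n_def)
  ultimately show ?case using p card by (intro exI[of _ "n # p"]) simp
qed

section \<open>The abacus with \<open>e\<close> runners\<close>

text \<open>\<open>Y t\<close> is the set of the heights of the beads on runner \<open>t\<close>.\<close>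

definition abacus :: "int \<Rightarrow> (int \<Rightarrow> int set) \<Rightarrow> int set" where
  "abacus e Y = {x. x div e \<in> Y (x mod e)}"

text \<open>
  These are the runner charges of the empty partition of charge \<open>s\<close>, whose beads are the integers
  below \<open>s\<close>: \<open>ground e s t\<close> is the least \<open>m\<close> with \<open>e * m + t \<ge> s\<close>.
\<close>

definition ground :: "int \<Rightarrow> int \<Rightarrow> int \<Rightarrow> int" where
  "ground e s t = (if t < s mod e then s div e + 1 else s div e)"

lemma sum_abacus:
  fixes f :: "int \<Rightarrow> int \<Rightarrow> 'a::comm_monoid_add"
  assumes "e > 0" and "\<And>t. t \<in> {0..<e} \<Longrightarrow> finite (Y t)"
  shows "(\<Sum>x\<in>abacus e Y. f (x mod e) (x div e)) = (\<Sum>t\<in>{0..<e}. \<Sum>m\<in>Y t. f t m)"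
proof -
  have "(\<Sum>t\<in>{0..<e}. \<Sum>m\<in>Y t. f t m) = (\<Sum>(t, m)\<in>(SIGMA t:{0..<e}. Y t). f t m)"
    using assms(2) by (intro sum.Sigma) auto
  also have "\<dots> = (\<Sum>x\<in>abacus e Y. f (x mod e) (x div e))"
    by (rule sum.reindex_bij_witness[of _ "\<lambda>x. (x mod e, x div e)" "\<lambda>(t, m). t + m * e"])
      (use assms(1) in \<open>auto simp: abacus_def\<close>)
  finally show ?thesis by simp
qed

lemma finite_abacus:
  assumes "e > 0" and "\<And>t. t \<in> {0..<e} \<Longrightarrow> finite (Y t)"
  shows "finite (abacus e Y)"
proof (rule finite_subset)
  show "abacus e Y \<subseteq> (\<lambda>(t, m). t + m * e) ` (SIGMA t:{0..<e}. Y t)"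
  proof
    fix x assume "x \<in> abacus e Y"
    then have "(x mod e, x div e) \<in> (SIGMA t:{0..<e}. Y t)" using assms(1) by (auto simp: abacus_def)
    then show "x \<in> (\<lambda>(t, m). t + m * e) ` (SIGMA t:{0..<e}. Y t)" by force
  qed
  show "finite ((\<lambda>(t, m). t + m * e) ` (SIGMA t:{0..<e}. Y t))"
    using assms(2) by (intro finite_imageI finite_SigmaI) auto
qed

lemma div_shift:
  fixes e i x :: int
  assumes "e > 0" and "0 \<le> i" and "i \<le> e"
  shows "(x - i) div e = x div e - (if x mod e < i then 1 else 0)"
proof -
  have x: "x = e * (x div e) + x mod e" by simp
  have b: "0 \<le> x mod e" "x mod e < e" using assms(1) by auto
  show ?thesis
  proof (cases "x mod e < i")
    case True
    have eq: "x - i = (x mod e - i + e) + e * (x div e - 1)" by (subst x) (simp add: algebra_simps)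
    have "(x - i) div e = (x div e - 1) + (x mod e - i + e) div e"
      by (subst eq, rule div_mult_self2) (use assms(1) in simp)
    then show ?thesis using True b assms by (simp add: div_pos_pos_trivial)
  next
    case False
    have eq: "x - i = (x mod e - i) + e * (x div e)" by (subst x) (simp add: algebra_simps)
    have "(x - i) div e = x div e + (x mod e - i) div e"
      by (subst eq, rule div_mult_self2) (use assms(1) in simp)
    then show ?thesis using False b assms by (simp add: div_pos_pos_trivial)
  qed
qed

text \<open>
  The first sum is independent of the residue \<open>i\<close> and the second depends on the beads only through
  their number on each runner. This is why residue counts see only charges and one total. The
  value \<open>i = e\<close> is allowed so that consecutive residues can be compared without wrapping around.
\<close>

lemma sum_abacus_div_shift:
  assumes "e > 0" and "\<And>t. t \<in> {0..<e} \<Longrightarrow> finite (Y t)" and "0 \<le> i" and "i \<le> e"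
  shows "(\<Sum>x\<in>abacus e Y. (x - i) div e) =
    (\<Sum>t\<in>{0..<e}. \<Sum>(Y t)) - (\<Sum>t\<in>{0..<i}. int (card (Y t)))"
proof -
  have "(\<Sum>x\<in>abacus e Y. (x - i) div e) =
      (\<Sum>x\<in>abacus e Y. x div e - (if x mod e < i then 1 else 0))"
    using assms by (simp add: div_shift)
  also have "\<dots> = (\<Sum>t\<in>{0..<e}. \<Sum>m\<in>Y t. m - (if t < i then 1 else 0))"
    using sum_abacus[where Y = Y and f = "\<lambda>t m. m - (if t < i then 1 else 0)"] assms(1,2) by simp
  also have "\<dots> = (\<Sum>t\<in>{0..<e}. \<Sum>(Y t) - (if t < i then int (card (Y t)) else 0))"
    by (intro sum.cong) (auto simp: sum_subtractf)
  also have "\<dots> = (\<Sum>t\<in>{0..<e}. \<Sum>(Y t)) - (\<Sum>t\<in>{0..<e}. if t < i then int (card (Y t)) else 0)"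
    by (simp add: sum_subtractf)
  also have "(\<Sum>t\<in>{0..<e}. if t < i then int (card (Y t)) else 0) = (\<Sum>t\<in>{0..<i}. int (card (Y t)))"
    using assms(4) by (intro sum.mono_neutral_cong_right) auto
  finally show ?thesis .
qed

lemma abacus_ground:
  assumes "e > 0"
  shows "abacus e (\<lambda>t. {-M..<ground e s t}) = {-(e * M)..<s}"
proof -
  have "x div e < ground e s (x mod e) \<longleftrightarrow> x < s" for x
  proof -
    have x: "x = e * (x div e) + x mod e" "0 \<le> x mod e" "x mod e < e" 
      and s: "s = e * (s div e) + s mod e" "0 \<le> s mod e" "s mod e < e" using assms by auto
    consider "x div e < s div e" | "x div e = s div e" | "x div e > s div e" by linarith
    then show ?thesis
    proof cases
      case 1
      then have "e * (x div e + 1) \<le> e * (s div e)" using assms by (intro mult_left_mono) auto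
      then have "x < s" using x s unfolding distrib_left by linarith
      with 1 show ?thesis by (auto simp: ground_def)
    next
      case 2
      then have "x mod e < s mod e \<longleftrightarrow> x < s" using x s by (metis add_less_cancel_left)
      with 2 show ?thesis by (auto simp: ground_def)
    next
      case 3
      then have "e * (s div e + 1) \<le> e * (x div e)" using assms by (intro mult_left_mono) auto
      then have "\<not> x < s" using x s unfolding distrib_left by linarith
      with 3 show ?thesis by (auto simp: ground_def)
    qed
  qed
  moreover have "-M \<le> x div e \<longleftrightarrow> -(e * M) \<le> x" for x
    using assms le_div_iff_mult_le[of e "-M" x] by (simp add: mult.commute)
  ultimately show ?thesis by (auto simp: abacus_def)
qed

lemma sum_card_abacus:
  assumes "e > 0" and "\<And>t. t \<in> {0..<e} \<Longrightarrow> finite (Y t)"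
  shows "(\<Sum>t\<in>{0..<e}. int (card (Y t))) = int (card (abacus e Y))"
  using sum_abacus[where Y = Y and f = "\<lambda>_ _. 1::int", OF assms] by simp

lemma ground_ge:
  fixes e s t M :: int
  assumes "e > 0" and "-(e * M) \<le> s"
  shows "-M \<le> ground e s t"
proof -
  have "-M \<le> s div e"
    using assms le_div_iff_mult_le[of e "-M" s] by (simp add: mult.commute)
  then show ?thesis by (simp add: ground_def)
qed

lemma sum_ground:
  assumes "e > 0"
  shows "(\<Sum>t\<in>{0..<e}. ground e s t) = s"
proof -
  \<comment> \<open>Count the integers from \<open>- e * M\<close> to \<open>s - 1\<close> runner by runner.\<close>
  define M where "M = \<bar>s\<bar>"
  have "\<bar>s\<bar> * 1 \<le> \<bar>s\<bar> * e" using assms by (intro mult_left_mono) auto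
  then have M: "-(e * M) \<le> s" unfolding M_def by (simp add: mult.commute)
  have "int (card {-M..<ground e s t}) = ground e s t + M" for t
    using ground_ge[OF assms M, of t] by simp
  then have "(\<Sum>t\<in>{0..<e}. ground e s t + M) = (\<Sum>t\<in>{0..<e}. int (card {-M..<ground e s t}))"
    by (simp only:)
  also have "\<dots> = int (card {-(e * M)..<s})"
    using sum_card_abacus[of e "\<lambda>t. {-M..<ground e s t}"] abacus_ground[OF assms] assms by simp
  also have "\<dots> = s + e * M" using M by simp
  finally show ?thesis using assms by (simp add: sum.distrib)
qed

lemma sum_atLeastLessThan_int:
  assumes "-M \<le> z"
  shows "2 * \<Sum>{-M..<z} = z * z - z - M * M - (M::int)"
  using assms
proof (induction z rule: int_ge_induct)
  case (step z)
  have "{-M..<z + 1} = insert z {-M..<z}" using step.hyps by auto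
  then show ?case using step by (simp add: algebra_simps)
qed (simp add: algebra_simps)

text \<open>
  Beads pushed down as far as possible minimise the sum of the heights. The excess is the number of
  rim hooks on the runner.
\<close>

lemma sum_ge_sum_interval:
  fixes Y :: "int set"
  assumes "finite Y" and "Y \<subseteq> {-M..}"
  shows "\<Sum>{-M..<int (card Y) - M} \<le> \<Sum>Y"
  using assms
proof (induction Y rule: finite_linorder_max_induct)
  case (insert m Y)
  have card: "card (insert m Y) = Suc (card Y)" using insert.hyps by auto
  have "insert m Y \<subseteq> {-M..m}" using insert.hyps(2) insert.prems by force
  then have "card (insert m Y) \<le> card {-M..m}" by (rule card_mono[rotated]) simp
  then have "int (card Y) - M \<le> m" using card by simp
  moreover have "{-M..<int (card (insert m Y)) - M} = insert (int (card Y) - M) {-M..<int (card Y) - M}"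
    using card by auto
  moreover have "\<Sum>(insert m Y) = m + \<Sum>Y" using insert.hyps by (intro sum.insert) auto
  ultimately show ?case using insert by simp
qed simp

section \<open>Partitions and their runner charges\<close>

text \<open>
  Twice the number of nodes of residue \<open>i\<close> in the \<open>e\<close>-core of charge \<open>s\<close> with runner charges \<open>z\<close>; the
  factor \<open>2\<close> avoids division.
\<close>

definition twice_core_count :: "int \<Rightarrow> int \<Rightarrow> (int \<Rightarrow> int) \<Rightarrow> int \<Rightarrow> int" where
  "twice_core_count e s z i = (\<Sum>t\<in>{0..<e}. (z t)\<^sup>2) - (\<Sum>t\<in>{0..<e}. (ground e s t)\<^sup>2)
     - 2 * (\<Sum>t\<in>{0..<i}. z t - ground e s t)"

text \<open>
  Heights are truncated at \<open>-M\<close>, so a runner of charge \<open>z t\<close> carries \<open>z t + M\<close> beads. Sums over the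
  intervals \<open>{-M..<z t}\<close> are quadratic in \<open>z t\<close>; their linear terms and all terms in \<open>M\<close> agree for \<open>z\<close>
  and for the empty partition, because both charge vectors have the sum \<open>s\<close>.
\<close>

lemma content_count_abacus:
  assumes e: "e > 0" and p: "sorted_wrt (\<ge>) p" and len: "int (length p) = s + e * M"
    and beta: "beta s p = abacus e Y"
    and fin: "\<And>t. t \<in> {0..<e} \<Longrightarrow> finite (Y t)"
    and card: "\<And>t. t \<in> {0..<e} \<Longrightarrow> int (card (Y t)) = z t + M"
    and W: "(\<Sum>t\<in>{0..<e}. \<Sum>(Y t)) = (\<Sum>t\<in>{0..<e}. \<Sum>{-M..<z t}) + W"
    and i: "0 \<le> i" "i \<le> e"
  shows "2 * int (content_count e s i p) = twice_core_count e s z i + 2 * W"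
proof -
  let ?g = "ground e s"
  have M: "-(e * M) \<le> s" using len by linarith
  have g: "-M \<le> ?g t" for t by (rule ground_ge[OF e M])
  have card_g: "int (card {-M..<?g t}) = ?g t + M" for t using g[of t] by simp
  have z: "-M \<le> z t" if "t \<in> {0..<e}" for t using card[OF that] by linarith
  have sum_z: "(\<Sum>t\<in>{0..<e}. z t) = s"
  proof -
    have "(\<Sum>t\<in>{0..<e}. z t + M) = (\<Sum>t\<in>{0..<e}. int (card (Y t)))"
      using card by (intro sum.cong) auto
    also have "\<dots> = int (card (beta s p))" using sum_card_abacus[OF e fin] beta by simp
    also have "\<dots> = s + e * M" using len by (simp add: beta_def card_image[OF inj_on_beta[OF p]])
    finally show ?thesis using e by (simp add: sum.distrib)
  qed
  have squares: "2 * (\<Sum>t\<in>{0..<e}. \<Sum>{-M..<f t}) = (\<Sum>t\<in>{0..<e}. (f t)\<^sup>2) - s - e * (M * M + M)"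
    if "\<And>t. t \<in> {0..<e} \<Longrightarrow> -M \<le> f t" "(\<Sum>t\<in>{0..<e}. f t) = s" for f
  proof -
    have "2 * (\<Sum>t\<in>{0..<e}. \<Sum>{-M..<f t}) = (\<Sum>t\<in>{0..<e}. (f t)\<^sup>2 - f t - (M * M + M))"
      by (subst sum_distrib_left, intro sum.cong refl)
        (use that(1) in \<open>simp add: sum_atLeastLessThan_int power2_eq_square\<close>)
    then show ?thesis using that(2) e by (simp add: sum_subtractf)
  qed
  have "int (content_count e s i p) =
      (\<Sum>x\<in>abacus e Y. (x - i) div e)
      - (\<Sum>x\<in>abacus e (\<lambda>t. {-M..<?g t}). (x - i) div e)"
    using content_count_beta[OF e p, of s i] len abacus_ground[OF e, of M s] beta by simp
  also have "\<dots> = (\<Sum>t\<in>{0..<e}. \<Sum>{-M..<z t}) + W - (\<Sum>t\<in>{0..<i}. int (card (Y t)))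
      - (\<Sum>t\<in>{0..<e}. \<Sum>{-M..<?g t}) + (\<Sum>t\<in>{0..<i}. int (card {-M..<?g t}))"
    using sum_abacus_div_shift[OF e fin i] sum_abacus_div_shift[OF e _ i, of "\<lambda>t. {-M..<?g t}"] W
    by simp
  also have "(\<Sum>t\<in>{0..<i}. int (card (Y t))) = (\<Sum>t\<in>{0..<i}. z t + M)"
    using card i by (intro sum.cong) auto
  also have "(\<Sum>t\<in>{0..<i}. int (card {-M..<?g t})) = (\<Sum>t\<in>{0..<i}. ?g t + M)"
    by (simp only: card_g)
  finally have "int (content_count e s i p) = (\<Sum>t\<in>{0..<e}. \<Sum>{-M..<z t}) + W
      - (\<Sum>t\<in>{0..<e}. \<Sum>{-M..<?g t}) - (\<Sum>t\<in>{0..<i}. z t - ?g t)"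
    by (simp add: sum.distrib sum_subtractf)
  then show ?thesis
    using squares[OF z sum_z] squares[OF g sum_ground[OF e]] unfolding twice_core_count_def by linarith
qed

lemma young_diagram_append_zeros: "young_diagram (p @ replicate k 0) = young_diagram p"
  by (auto simp: young_diagram_def nth_append split: if_splits)

lemma partition_append_zeros:
  assumes "sorted_wrt (\<ge>) p"
  shows "\<exists>q k. is_partition q \<and> p = q @ replicate k 0"
  using assms
proof (induction p)
  case Nil
  show ?case by (auto simp: is_partition_def)
next
  case (Cons x p)
  have "sorted_wrt (\<ge>) p" using Cons.prems by simp
  from Cons.IH[OF this] obtain q k where q: "is_partition q" "p = q @ replicate k 0" by blast
  show ?case
  proof (cases "x = 0")
    case True
    then have "\<forall>y\<in>set p. y = 0" using Cons.prems by simp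
    then have "p = replicate (length p) 0" by (simp add: replicate_length_same)
    then have "x # p = [] @ replicate (Suc (length p)) 0" using True by simp
    moreover have "is_partition []" by (simp add: is_partition_def)
    ultimately show ?thesis by blast
  next
    case False
    then show ?thesis using q Cons.prems
      by (intro exI[of _ "x # q"] exI[of _ k]) (auto simp: is_partition_def)
  qed
qed

lemma content_count_append_zeros:
  "content_count e s i (p @ replicate k 0) = content_count e s i p"
  by (simp add: content_count_def young_diagram_append_zeros)

lemma partition_charges:
  assumes e: "e > 0" and p: "is_partition p"
  obtains z W where "(\<Sum>t\<in>{0..<e}. z t) = s" and "W \<ge> 0"
    and "\<And>i. 0 \<le> i \<Longrightarrow> i \<le> e \<Longrightarrow> 2 * int (content_count e s i p) = twice_core_count e s z i + 2 * W"
proof -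
  \<comment> \<open>With \<open>k\<close> zeros added, exactly the beads below height \<open>-M\<close> are cut off.\<close>
  define M where "M = \<bar>s\<bar> + int (length p)"
  define k where "k = nat (s + e * M - int (length p))"
  define q where "q = p @ replicate k 0"
  have "1 * M \<le> e * M" using e by (intro mult_right_mono) (auto simp: M_def)
  moreover have "int (length p) - s \<le> M" by (simp add: M_def)
  ultimately have len: "int (length q) = s + e * M" by (simp add: q_def k_def)
  have q: "sorted_wrt (\<ge>) q"
  proof -
    have "sorted_wrt (\<ge>) (replicate k (0::nat))" by (induction k) auto
    then show ?thesis using p by (auto simp: is_partition_def q_def sorted_wrt_append)
  qed
  define Y where "Y t = (\<lambda>x. x div e) ` {x \<in> beta s q. x mod e = t}" for t
  define z where "z t = int (card (Y t)) - M" for t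
  define W where "W = (\<Sum>t\<in>{0..<e}. \<Sum>(Y t)) - (\<Sum>t\<in>{0..<e}. \<Sum>{-M..<z t})"
  have fin: "finite (Y t)" for t by (simp add: Y_def beta_def)
  have beta: "beta s q = abacus e Y"
    by (auto simp: abacus_def Y_def) (metis mult_div_mod_eq)
  have ge: "-M \<le> m" if "m \<in> Y t" for m t
  proof -
    from that obtain x where x: "x \<in> beta s q" "m = x div e" by (auto simp: Y_def)
    from x(1) len have "-M * e \<le> x" by (auto simp: beta_def algebra_simps)
    then show ?thesis using e x(2) by (simp add: le_div_iff_mult_le)
  qed
  have "W \<ge> 0" unfolding W_def z_def
    using sum_mono[of "{0..<e}" "\<lambda>t. \<Sum>{-M..<int (card (Y t)) - M}" "\<lambda>t. \<Sum>(Y t)"]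
      sum_ge_sum_interval[OF fin, of _ M] ge by (auto simp: subset_iff)
  moreover have "2 * int (content_count e s i p) = twice_core_count e s z i + 2 * W" if "0 \<le> i" "i \<le> e" for i
    using content_count_abacus[OF e q len beta fin, of z W i] that
    by (simp add: z_def W_def q_def content_count_append_zeros)
  moreover have "(\<Sum>t\<in>{0..<e}. z t) = s"
  proof -
    have "(\<Sum>t\<in>{0..<e}. int (card (Y t))) = int (card (beta s q))"
      using sum_card_abacus[OF e fin] beta by simp
    also have "\<dots> = s + e * M" using len by (simp add: beta_def card_image[OF inj_on_beta[OF q]])
    finally show ?thesis using e by (simp add: z_def sum_subtractf)
  qed
  ultimately show thesis using that by blast
qed

lemma ex_partition_with_charges:
  assumes e: "e > 0" and z: "(\<Sum>t\<in>{0..<e}. z t) = s" and W: "W \<ge> 0"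
  obtains p where "is_partition p"
    and "\<And>i. 0 \<le> i \<Longrightarrow> i \<le> e \<Longrightarrow> 2 * int (content_count e s i p) = twice_core_count e s z i + 2 * W"
proof -
  define M where "M = 1 + (\<Sum>t\<in>{0..<e}. \<bar>z t\<bar>)"
  have M: "-M < z t" if "t \<in> {0..<e}" for t
  proof -
    have "\<bar>z t\<bar> \<le> (\<Sum>t\<in>{0..<e}. \<bar>z t\<bar>)" using that by (intro member_le_sum) auto
    then show ?thesis by (simp add: M_def)
  qed
  \<comment> \<open>Start from the core and raise the top bead of runner \<open>0\<close> by \<open>W\<close>.\<close>
  define Y where "Y t = (if t = 0 then insert (z 0 - 1 + W) {-M..<z 0 - 1} else {-M..<z t})" for t
  have fin: "finite (Y t)" for t by (simp add: Y_def)
  have M0: "-M < z 0" using M e by simp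
  have card: "int (card (Y t)) = z t + M" if "t \<in> {0..<e}" for t
    using M[OF that] W by (auto simp: Y_def)
  have "{-M..<z 0} = insert (z 0 - 1) {-M..<z 0 - 1}" using M0 by auto
  then have "\<Sum>(Y t) = \<Sum>{-M..<z t} + (if t = 0 then W else 0)" if "t \<in> {0..<e}" for t
    using W by (auto simp: Y_def)
  then have "(\<Sum>t\<in>{0..<e}. \<Sum>(Y t)) = (\<Sum>t\<in>{0..<e}. \<Sum>{-M..<z t} + (if t = 0 then W else 0))"
    by (intro sum.cong) auto
  also have "\<dots> = (\<Sum>t\<in>{0..<e}. \<Sum>{-M..<z t}) + W" using e by (simp add: sum.distrib)
  finally have sumW: "(\<Sum>t\<in>{0..<e}. \<Sum>(Y t)) = (\<Sum>t\<in>{0..<e}. \<Sum>{-M..<z t}) + W" .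
  have cardA: "int (card (abacus e Y)) = s + e * M"
    using sum_card_abacus[where Y = Y, OF e fin] card e z by (simp add: sum.distrib)
  have ge: "m \<ge> -M" if "m \<in> Y t" for m t
    using that M0 W by (auto simp: Y_def split: if_splits)
  have "-(e * M) \<le> x" if "x \<in> abacus e Y" for x
  proof -
    have "-M \<le> x div e" using ge[of "x div e" "x mod e"] that by (simp add: abacus_def)
    then show ?thesis using le_div_iff_mult_le[OF e, of "-M" x] by (simp add: mult.commute)
  qed
  then have "abacus e Y \<subseteq> {s - int (card (abacus e Y))..}" using cardA by auto
  from ex_beta_eq[OF finite_abacus[OF e fin] this]
  obtain p where p: "sorted_wrt (\<ge>) p" "length p = card (abacus e Y)" "beta s p = abacus e Y"
    by auto
  obtain q k where q: "is_partition q" "p = q @ replicate k 0"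
    using partition_append_zeros[OF p(1)] by blast
  have "2 * int (content_count e s i q) = twice_core_count e s z i + 2 * W" if "0 \<le> i" "i \<le> e" for i
    using content_count_abacus[OF e p(1) _ p(3) fin card sumW that] p(2) cardA q(2)
    by (simp add: content_count_append_zeros)
  then show thesis using that q(1) by blast
qed

section \<open>Multipartitions and charge matrices\<close>

lemma sum_twice_core_count:
  "(\<Sum>j<r. twice_core_count e (s j) (z j) i) =
     (\<Sum>j<r. \<Sum>t\<in>{0..<e}. (z j t)\<^sup>2) - (\<Sum>j<r. \<Sum>t\<in>{0..<e}. (ground e (s j) t)\<^sup>2)
     - 2 * (\<Sum>t\<in>{0..<i}. (\<Sum>j<r. z j t) - (\<Sum>j<r. ground e (s j) t))"
proof -
  have "(\<Sum>j<r. \<Sum>t\<in>{0..<i}. z j t - ground e (s j) t) =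
      (\<Sum>t\<in>{0..<i}. (\<Sum>j<r. z j t) - (\<Sum>j<r. ground e (s j) t))"
    by (subst sum.swap) (simp add: sum_subtractf)
  then show ?thesis by (simp add: twice_core_count_def sum_subtractf sum_distrib_left[symmetric])
qed

lemma res_count_eq_sum:
  assumes "length \<Lambda> = length s"
  shows "res_count e s i \<Lambda> = (\<Sum>j<length s. content_count (int e) (s ! j) i (\<Lambda> ! j))"
proof -
  let ?C = "\<lambda>j. {(a, b) \<in> young_diagram (\<Lambda> ! j). (int b - int a + s ! j) mod int e = i mod int e}"
  let ?N = "{n \<in> nodes \<Lambda>. residue e s n = i mod int e}"
  have bij: "bij_betw (\<lambda>(j, a, b). (a, b, j)) (SIGMA j:{..<length s}. ?C j) ?N"
    by (rule bij_betw_byWitness[where f' = "\<lambda>(a, b, j). (j, a, b)"])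
      (auto simp: nodes_def residue_def assms)
  have "res_count e s i \<Lambda> = card (SIGMA j:{..<length s}. ?C j)"
    unfolding res_count_def by (rule bij_betw_same_card[OF bij, symmetric])
  also have "\<dots> = (\<Sum>j<length s. card (?C j))"
  proof (rule card_SigmaI)
    show "\<forall>j\<in>{..<length s}. finite (?C j)"
      by (intro ballI finite_subset[OF _ finite_young_diagram]) auto
  qed simp
  finally show ?thesis by (simp only: content_count_def)
qed

lemma res_count_mod: "res_count e s (i mod int e) \<Lambda> = res_count e s i \<Lambda>"
  by (simp add: res_count_def)

lemma alpha_eq_diff_delta:
  assumes "\<And>i. i \<in> {0..<int e} \<Longrightarrow> int (res_count e s i \<Lambda>') = int (res_count e s i \<Lambda>) - 1"
  shows "alpha e s \<Lambda>' = alpha e s \<Lambda> - delta e"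
proof -
  have "alpha e s \<Lambda>' = (\<Sum>i\<in>{0..<int e}. frag_cmul (int (res_count e s i \<Lambda>) - 1) (frag_of i))"
    unfolding alpha_def using assms by (intro sum.cong) auto
  then show ?thesis
    by (simp add: alpha_def delta_def frag_cmul_diff_distrib sum_subtractf)
qed

text \<open>
  Row \<open>j\<close> of \<open>z\<close> holds the runner charges of component \<open>j\<close>, and \<open>W\<close> is the total number of rim hooks
  over all components. Only the consequence for the residue counts is recorded, since blocks and
  weights depend on nothing else.
\<close>

definition has_charges ::
    "nat \<Rightarrow> int list \<Rightarrow> nat list list \<Rightarrow> (nat \<Rightarrow> int \<Rightarrow> int) \<Rightarrow> int \<Rightarrow> bool" where
  "has_charges e s \<Lambda> z W \<longleftrightarrow>
     W \<ge> 0 \<and> (\<forall>j<length s. (\<Sum>t\<in>{0..<int e}. z j t) = s ! j) \<and>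
     (\<forall>i. 0 \<le> i \<longrightarrow> i \<le> int e \<longrightarrow>
        2 * int (res_count e s i \<Lambda>) = (\<Sum>j<length s. twice_core_count (int e) (s ! j) (z j) i) + 2 * W)"

lemma ex_has_charges:
  assumes "e > 0" and "is_multipartition (length s) \<Lambda>"
  shows "\<exists>z W. has_charges e s \<Lambda> z W"
proof -
  have "\<exists>z W. (\<Sum>t\<in>{0..<int e}. z t) = s ! j \<and> W \<ge> 0 \<and> (\<forall>i. 0 \<le> i \<longrightarrow> i \<le> int e \<longrightarrow>
      2 * int (content_count (int e) (s ! j) i (\<Lambda> ! j)) = twice_core_count (int e) (s ! j) z i + 2 * W)"
    if "j < length s" for j
  proof -
    have "is_partition (\<Lambda> ! j)" using assms(2) that by (auto simp: is_multipartition_def)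
    with assms(1) show ?thesis
      using partition_charges[of "int e" "\<Lambda> ! j" "s ! j"] by (metis of_nat_0_less_iff)
  qed
  then obtain z W where zW: "\<And>j. j < length s \<Longrightarrow> (\<Sum>t\<in>{0..<int e}. z j t) = s ! j"
      "\<And>j. j < length s \<Longrightarrow> W j \<ge> 0"
      "\<And>j i. j < length s \<Longrightarrow> 0 \<le> i \<Longrightarrow> i \<le> int e \<Longrightarrow>
        2 * int (content_count (int e) (s ! j) i (\<Lambda> ! j)) = twice_core_count (int e) (s ! j) (z j) i + 2 * W j"
    by metis
  have len: "length \<Lambda> = length s" using assms(2) by (simp add: is_multipartition_def)
  have "has_charges e s \<Lambda> z (\<Sum>j<length s. W j)"
    unfolding has_charges_def using zW
    by (auto simp: res_count_eq_sum[OF len] sum_distrib_left sum.distrib intro!: sum_nonneg)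
  then show ?thesis by blast
qed

lemma ex_multipartition_with_charges:
  assumes "e > 0" and "length s > 0" and "W \<ge> 0"
    and "\<And>j. j < length s \<Longrightarrow> (\<Sum>t\<in>{0..<int e}. z j t) = s ! j"
  shows "\<exists>\<Lambda>. is_multipartition (length s) \<Lambda> \<and> has_charges e s \<Lambda> z W"
proof -
  \<comment> \<open>Only the total of the rim hooks counts, so component \<open>0\<close> can carry all of them.\<close>
  define V where "V j = (if j = 0 then W else 0)" for j :: nat
  have "\<exists>p. is_partition p \<and> (\<forall>i. 0 \<le> i \<longrightarrow> i \<le> int e \<longrightarrow>
      2 * int (content_count (int e) (s ! j) i p) = twice_core_count (int e) (s ! j) (z j) i + 2 * V j)"
    if "j < length s" for j
    using ex_partition_with_charges[of "int e" "z j" "s ! j" "V j"] assms that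
    by (metis V_def of_nat_0_less_iff order_refl)
  then obtain p where p: "\<And>j. j < length s \<Longrightarrow> is_partition (p j)"
      "\<And>j i. j < length s \<Longrightarrow> 0 \<le> i \<Longrightarrow> i \<le> int e \<Longrightarrow>
        2 * int (content_count (int e) (s ! j) i (p j)) = twice_core_count (int e) (s ! j) (z j) i + 2 * V j"
    by metis
  define \<Lambda> where "\<Lambda> = map p [0..<length s]"
  have len: "length \<Lambda> = length s" by (simp add: \<Lambda>_def)
  have "(\<Sum>j<length s. V j) = W" using assms(2) by (simp add: V_def)
  then have "has_charges e s \<Lambda> z W"
    unfolding has_charges_def using assms p(2)
    by (auto simp: res_count_eq_sum[OF len] sum_distrib_left[symmetric] sum.distrib)
      (simp add: \<Lambda>_def sum_distrib_left sum.distrib)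
  moreover have "is_multipartition (length s) \<Lambda>"
    using p(1) by (auto simp: is_multipartition_def \<Lambda>_def)
  ultimately show ?thesis by blast
qed

section \<open>Charge matrices of core blocks\<close>

text \<open>
  Equal column sums make the residue counts differ by a constant, and the drop of \<open>2\<close> makes that
  constant \<open>1\<close>: a matrix attaining equality would realise the block minus \<open>\<delta>\<close>.
\<close>

lemma reduced_charges_minimal:
  assumes "e > 0" and "length s > 0" and red: "is_reduced_multicore e s \<Lambda>"
    and z: "has_charges e s \<Lambda> z W" and "W' \<ge> 0"
    and rows: "\<And>j. j < length s \<Longrightarrow> (\<Sum>t\<in>{0..<int e}. z' j t) = (\<Sum>t\<in>{0..<int e}. z j t)"
    and cols: "\<And>t. (\<Sum>j<length s. z' j t) = (\<Sum>j<length s. z j t)"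
  shows "(\<Sum>j<length s. \<Sum>t\<in>{0..<int e}. (z' j t)\<^sup>2) + 2 * W'
    \<noteq> (\<Sum>j<length s. \<Sum>t\<in>{0..<int e}. (z j t)\<^sup>2) + 2 * W - 2"
proof
  assume eq: "(\<Sum>j<length s. \<Sum>t\<in>{0..<int e}. (z' j t)\<^sup>2) + 2 * W'
    = (\<Sum>j<length s. \<Sum>t\<in>{0..<int e}. (z j t)\<^sup>2) + 2 * W - 2"
  have "(\<Sum>t\<in>{0..<int e}. z' j t) = s ! j" if "j < length s" for j
    using rows z that by (simp add: has_charges_def)
  from ex_multipartition_with_charges[OF assms(1,2) \<open>W' \<ge> 0\<close> this]
  obtain \<Lambda>' where \<Lambda>': "is_multipartition (length s) \<Lambda>'" "has_charges e s \<Lambda>' z' W'"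
    by blast
  have "int (res_count e s i \<Lambda>') = int (res_count e s i \<Lambda>) - 1" if "i \<in> {0..<int e}" for i
  proof -
    have "2 * int (res_count e s i \<Lambda>') = (\<Sum>j<length s. twice_core_count (int e) (s ! j) (z' j) i) + 2 * W'"
      "2 * int (res_count e s i \<Lambda>) = (\<Sum>j<length s. twice_core_count (int e) (s ! j) (z j) i) + 2 * W"
      using \<Lambda>'(2) z that by (simp_all add: has_charges_def)
    then show ?thesis using eq by (simp add: sum_twice_core_count cols)
  qed
  then have "alpha e s \<Lambda>' = alpha e s \<Lambda> - delta e" by (rule alpha_eq_diff_delta)
  then have "alpha e s \<Lambda> - delta e \<in> Q_blocks e s" using \<Lambda>'(1) by (force simp: Q_blocks_def)
  then show False using red by (simp add: is_reduced_multicore_def is_core_block_def)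
qed

lemma sum_of_bool_diff_mult:
  fixes f :: "'a \<Rightarrow> int"
  assumes "finite A" and "k \<in> A" and "j \<in> A"
  shows "(\<Sum>a\<in>A. (of_bool (a = k) - of_bool (a = j)) * f a) = f k - f j"
proof -
  have "(\<Sum>a\<in>A. of_bool (a = c) * f a) = f c" if "c \<in> A" for c
    using assms(1) that by (simp add: of_bool_def if_distrib[of "\<lambda>x. x * _"] cong: if_cong)
  then show ?thesis using assms by (simp add: left_diff_distrib sum_subtractf)
qed

text \<open>The perturbation has rank one, so its cross term with \<open>z\<close> is an alternating sum of four entries.\<close>

lemma sum_sq_swap:
  fixes z :: "'a \<Rightarrow> 'b \<Rightarrow> int"
  assumes "finite A" "finite B" "j \<in> A" "k \<in> A" "j \<noteq> k" "t \<in> B" "u \<in> B" "t \<noteq> u"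
  defines "g \<equiv> \<lambda>a. of_bool (a = k) - of_bool (a = j)"
    and "h \<equiv> \<lambda>b. of_bool (b = t) - of_bool (b = u)"
  shows "(\<Sum>a\<in>A. \<Sum>b\<in>B. (z a b + g a * h b)\<^sup>2)
    = (\<Sum>a\<in>A. \<Sum>b\<in>B. (z a b)\<^sup>2) - 2 * (z j t - z k t - z j u + z k u) + 4"
proof -
  have g: "(\<Sum>a\<in>A. g a * f a) = f k - f j" for f
    unfolding g_def using assms by (intro sum_of_bool_diff_mult) auto
  have h: "(\<Sum>b\<in>B. h b * f b) = f t - f u" for f
    unfolding h_def using assms by (intro sum_of_bool_diff_mult) auto
  have hh: "(\<Sum>b\<in>B. h b * h b) = 2" using assms(8) by (simp add: h) (simp add: h_def)
  have gg: "(\<Sum>a\<in>A. g a * (g a * 2)) = 4" using assms(5) by (simp add: g) (simp add: g_def)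
  have inner: "(\<Sum>b\<in>B. (z a b + g a * h b)\<^sup>2)
      = (\<Sum>b\<in>B. (z a b)\<^sup>2) + 2 * (g a * (z a t - z a u)) + g a * (g a * 2)" for a
  proof -
    have "(\<Sum>b\<in>B. (z a b + g a * h b)\<^sup>2)
        = (\<Sum>b\<in>B. (z a b)\<^sup>2 + 2 * g a * (h b * z a b) + g a * g a * (h b * h b))"
      by (intro sum.cong) (auto simp: power2_eq_square algebra_simps)
    then show ?thesis
      by (simp add: sum.distrib sum_distrib_left[symmetric] h[of "z a"] hh)
  qed
  show ?thesis
    unfolding inner sum.distrib gg sum_distrib_left[symmetric] g[of "\<lambda>a. z a t - z a u"]
    by (simp add: algebra_simps)
qed

text \<open>
  If the alternating sum \<open>D\<close> were at least \<open>3\<close>, moving one unit along the rectangle would lower the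
  squared norm by \<open>2 D - 4 \<ge> 2\<close>. Adding \<open>D - 3\<close> rim hooks makes the drop of \<open>|z|\<^sup>2 + 2 W\<close> exactly \<open>2\<close>,
  against minimality.
\<close>

lemma reduced_charges_minor_le:
  assumes "e > 0" and red: "is_reduced_multicore e s \<Lambda>" and z: "has_charges e s \<Lambda> z W"
    and jk: "j < length s" "k < length s" and tu: "t \<in> {0..<int e}" "u \<in> {0..<int e}"
  shows "z j t - z k t - z j u + z k u \<le> 2"
proof (rule ccontr)
  assume D: "\<not> z j t - z k t - z j u + z k u \<le> 2"
  then have neq: "j \<noteq> k" "t \<noteq> u" by auto
  define g :: "nat \<Rightarrow> int" where "g a = of_bool (a = k) - of_bool (a = j)" for a
  define h :: "int \<Rightarrow> int" where "h b = of_bool (b = t) - of_bool (b = u)" for b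
  define z' where "z' a b = z a b + g a * h b" for a b
  have g: "(\<Sum>a<length s. g a) = 0"
    using sum_of_bool_diff_mult[of "{..<length s}" k j "\<lambda>_. 1"] jk by (simp add: g_def)
  have h: "(\<Sum>b\<in>{0..<int e}. h b) = 0"
    using sum_of_bool_diff_mult[of "{0..<int e}" t u "\<lambda>_. 1"] tu by (simp add: h_def)
  have "(\<Sum>a<length s. \<Sum>b\<in>{0..<int e}. (z' a b)\<^sup>2) + 2 * (W + (z j t - z k t - z j u + z k u) - 3)
      = (\<Sum>a<length s. \<Sum>b\<in>{0..<int e}. (z a b)\<^sup>2) + 2 * W - 2"
    using sum_sq_swap[of "{..<length s}" "{0..<int e}" j k t u z] jk tu neq
    by (simp add: z'_def g_def h_def)
  moreover have "W + (z j t - z k t - z j u + z k u) - 3 \<ge> 0"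
    using D z by (simp add: has_charges_def)
  moreover have "(\<Sum>b\<in>{0..<int e}. z' a b) = (\<Sum>b\<in>{0..<int e}. z a b)" for a
    by (simp add: z'_def sum.distrib sum_distrib_left[symmetric] h)
  moreover have "(\<Sum>a<length s. z' a b) = (\<Sum>a<length s. z a b)" for b
    by (simp add: z'_def sum.distrib sum_distrib_right[symmetric] g)
  moreover have "length s > 0" using jk by linarith
  ultimately show False
    using reduced_charges_minimal[OF assms(1) _ red z, of _ z'] by blast
qed

lemma reduced_charges_weight_zero:
  assumes "e > 0" and "length s > 0" and "is_reduced_multicore e s \<Lambda>" and z: "has_charges e s \<Lambda> z W"
  shows "W = 0"
proof (rule ccontr)
  assume "W \<noteq> 0"
  then have "W - 1 \<ge> 0" using z by (simp add: has_charges_def)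
  from reduced_charges_minimal[OF assms this, of z] show False by simp
qed

section \<open>Bounding the weight\<close>

text \<open>
  Lagrange's identity. It turns the weight into a sum over pairs of components, and it measures how
  far a vector is from the constant vector with the same sum.
\<close>

lemma sum_sq_differences:
  fixes f :: "'a \<Rightarrow> int"
  shows "(\<Sum>a\<in>A. \<Sum>b\<in>A. (f a - f b)\<^sup>2) = 2 * (int (card A) * (\<Sum>a\<in>A. (f a)\<^sup>2) - (\<Sum>a\<in>A. f a)\<^sup>2)"
proof -
  have "(\<Sum>a\<in>A. \<Sum>b\<in>A. (f a - f b)\<^sup>2)
      = (\<Sum>a\<in>A. \<Sum>b\<in>A. (f a)\<^sup>2) + (\<Sum>a\<in>A. \<Sum>b\<in>A. (f b)\<^sup>2) - 2 * (\<Sum>a\<in>A. \<Sum>b\<in>A. f a * f b)"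
    by (simp add: power2_diff sum.distrib sum_subtractf sum_distrib_left mult.assoc)
  also have "(\<Sum>a\<in>A. \<Sum>b\<in>A. f a * f b) = (\<Sum>a\<in>A. f a)\<^sup>2"
    by (simp add: power2_eq_square sum_product)
  finally show ?thesis by (simp add: sum_distrib_left[symmetric])
qed

text \<open>
  With \<open>n\<close> coordinates of sum \<open>S\<close>, the quantity \<open>n |x|\<^sup>2 - S\<^sup>2\<close> is half the sum of the squared
  differences. It is non-negative for \<open>w\<close> and at most \<open>2 n\<^sup>2\<close> for \<open>v\<close>.
\<close>

lemma sum_sq_le_of_small_differences:
  fixes v w :: "'a \<Rightarrow> int"
  assumes "finite A" and "(\<Sum>a\<in>A. v a) = (\<Sum>a\<in>A. w a)"
    and "\<And>a b. a \<in> A \<Longrightarrow> b \<in> A \<Longrightarrow> \<bar>v a - v b\<bar> \<le> 2"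
  shows "(\<Sum>a\<in>A. (v a)\<^sup>2) \<le> (\<Sum>a\<in>A. (w a)\<^sup>2) + 2 * int (card A)"
proof (cases "A = {}")
  case False
  let ?n = "int (card A)"
  have n: "?n > 0" using False assms(1) by (simp add: card_gt_0_iff)
  have "(v a - v b)\<^sup>2 \<le> 4" if "a \<in> A" "b \<in> A" for a b
    using abs_le_square_iff[of "v a - v b" 2] assms(3)[OF that] by simp
  then have "(\<Sum>a\<in>A. \<Sum>b\<in>A. (v a - v b)\<^sup>2) \<le> (\<Sum>a\<in>A. \<Sum>b\<in>A. 4)"
    by (intro sum_mono) auto
  then have "?n * (\<Sum>a\<in>A. (v a)\<^sup>2) \<le> (\<Sum>a\<in>A. w a)\<^sup>2 + 2 * ?n * ?n"
    unfolding sum_sq_differences assms(2) by simp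
  moreover have "0 \<le> (\<Sum>a\<in>A. \<Sum>b\<in>A. (w a - w b)\<^sup>2)" by (intro sum_nonneg) simp
  ultimately have "?n * (\<Sum>a\<in>A. (v a)\<^sup>2) \<le> ?n * ((\<Sum>a\<in>A. (w a)\<^sup>2) + 2 * ?n)"
    unfolding sum_sq_differences by (simp add: algebra_simps)
  then show ?thesis using n by simp
qed simp

text \<open>
  Up to a constant vector, \<open>ground e s\<close> is the indicator of \<open>{0..<s mod e}\<close>. Thus the partial sum in
  the count of the nodes of residue \<open>s\<close> is an inner product with the charges of the empty partition.
\<close>

lemma sum_ground_mult:
  assumes "e > 0" and "(\<Sum>t\<in>{0..<e}. y t) = 0"
  shows "(\<Sum>t\<in>{0..<e}. ground e s t * y t) = (\<Sum>t\<in>{0..<s mod e}. y t)"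
proof -
  have "(\<Sum>t\<in>{0..<e}. ground e s t * y t)
      = (\<Sum>t\<in>{0..<e}. s div e * y t + (if t < s mod e then y t else 0))"
    by (intro sum.cong) (auto simp: ground_def algebra_simps)
  also have "\<dots> = (\<Sum>t\<in>{0..<e}. if t < s mod e then y t else 0)"
    by (simp add: sum.distrib sum_distrib_left[symmetric] assms(2))
  also have "\<dots> = (\<Sum>t\<in>{0..<s mod e}. y t)"
    using less_imp_le[OF pos_mod_bound[OF assms(1), of s]]
    by (intro sum.mono_neutral_cong_right) auto
  finally show ?thesis .
qed

text \<open>
  With \<open>Z\<close> and \<open>G\<close> the column sums of \<open>z\<close> and of the ground charges, the counts at the charges \<open>s\<^sub>j\<close>
  contribute the inner product of \<open>G\<close> and \<open>Z - G\<close>, and consecutive counts differ by the entries of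
  \<open>Z - G\<close>. Twice that product plus \<open>|Z - G|\<^sup>2\<close> is \<open>|Z|\<^sup>2 - |G|\<^sup>2\<close>, so twice the weight for \<open>W = 0\<close> is the value of
  \<open>r \<Sum>\<^sub>j |z\<^sub>j|\<^sup>2 - |Z|\<^sup>2\<close> minus the same expression in the ground charges. By Lagrange's identity
  this involves only differences of rows.
\<close>

lemma weight_charges:
  assumes e: "e > 0" and z: "has_charges e s \<Lambda> z W"
  shows "4 * weight e s \<Lambda> = real_of_int (4 * int (length s) * W +
    (\<Sum>j<length s. \<Sum>k<length s.
      (\<Sum>t\<in>{0..<int e}. (z j t - z k t)\<^sup>2)
      - (\<Sum>t\<in>{0..<int e}. (ground (int e) (s ! j) t - ground (int e) (s ! k) t)\<^sup>2)))"
proof -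
  let ?r = "length s" and ?I = "{0..<int e}"
  let ?c = "\<lambda>i. int (res_count e s i \<Lambda>)" and ?g = "\<lambda>j. ground (int e) (s ! j)"
  define Z where "Z t = (\<Sum>j<?r. z j t)" for t
  define G where "G t = (\<Sum>j<?r. ?g j t)" for t
  define E where "E = (\<Sum>j<?r. \<Sum>t\<in>?I. (z j t)\<^sup>2)"
  define F where "F = (\<Sum>j<?r. \<Sum>t\<in>?I. (?g j t)\<^sup>2)"
  have c: "2 * ?c i = E - F - 2 * (\<Sum>t\<in>{0..<i}. Z t - G t) + 2 * W" if "0 \<le> i" "i \<le> int e" for i
    using z that by (simp add: has_charges_def sum_twice_core_count Z_def G_def E_def F_def)
  have total: "(\<Sum>t\<in>?I. Z t - G t) = 0"
  proof -
    have "(\<Sum>t\<in>?I. Z t) = (\<Sum>j<?r. s ! j)"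
      unfolding Z_def using z by (subst sum.swap) (simp add: has_charges_def)
    moreover have "(\<Sum>t\<in>?I. G t) = (\<Sum>j<?r. s ! j)"
      unfolding G_def using e by (subst sum.swap) (simp add: sum_ground)
    ultimately show ?thesis by (simp add: sum_subtractf)
  qed
  have step: "?c i - ?c (i + 1) = Z i - G i" if "i \<in> ?I" for i
  proof -
    have "{0..<i + 1} = insert i {0..<i}" using that by auto
    then show ?thesis using c[of i] c[of "i + 1"] that by simp
  qed
  have charge: "2 * ?c (s ! j) = E - F - 2 * (\<Sum>t\<in>?I. ?g j t * (Z t - G t)) + 2 * W" for j
    using c[of "(s ! j) mod int e"] e sum_ground_mult[OF _ total, of "s ! j"]
      less_imp_le[OF pos_mod_bound[of "int e" "s ! j"]]
    by (simp add: res_count_mod)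
  have "2 * (\<Sum>j<?r. ?c (s ! j)) = (\<Sum>j<?r. E - F - 2 * (\<Sum>t\<in>?I. ?g j t * (Z t - G t)) + 2 * W)"
    unfolding sum_distrib_left charge ..
  also have "\<dots> = int ?r * (E - F + 2 * W) - 2 * (\<Sum>j<?r. \<Sum>t\<in>?I. ?g j t * (Z t - G t))"
    by (simp add: sum.distrib sum_subtractf sum_distrib_left[symmetric] algebra_simps)
  also have "(\<Sum>j<?r. \<Sum>t\<in>?I. ?g j t * (Z t - G t)) = (\<Sum>t\<in>?I. G t * (Z t - G t))"
    by (subst sum.swap) (simp add: G_def sum_distrib_right)
  finally have charges: "2 * (\<Sum>j<?r. ?c (s ! j))
      = int ?r * (E - F + 2 * W) - 2 * (\<Sum>t\<in>?I. G t * (Z t - G t))" .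
  have steps: "(\<Sum>i\<in>?I. (?c i - ?c (i + 1))\<^sup>2) = (\<Sum>t\<in>?I. (Z t - G t)\<^sup>2)"
    using step by (intro sum.cong) auto
  have squares: "2 * (\<Sum>t\<in>?I. G t * (Z t - G t)) + (\<Sum>t\<in>?I. (Z t - G t)\<^sup>2)
      = (\<Sum>t\<in>?I. (Z t)\<^sup>2) - (\<Sum>t\<in>?I. (G t)\<^sup>2)"
    unfolding sum_distrib_left sum.distrib[symmetric] sum_subtractf[symmetric]
    by (intro sum.cong) (auto simp: power2_eq_square algebra_simps)
  have pairs: "(\<Sum>j<?r. \<Sum>k<?r. \<Sum>t\<in>?I. (f j t - f k t)\<^sup>2)
      = 2 * (int ?r * (\<Sum>j<?r. \<Sum>t\<in>?I. (f j t)\<^sup>2) - (\<Sum>t\<in>?I. (\<Sum>j<?r. f j t)\<^sup>2))" for f :: "nat \<Rightarrow> int \<Rightarrow> int"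
  proof -
    have "(\<Sum>j<?r. \<Sum>k<?r. \<Sum>t\<in>?I. (f j t - f k t)\<^sup>2)
        = (\<Sum>j<?r. \<Sum>t\<in>?I. \<Sum>k<?r. (f j t - f k t)\<^sup>2)"
      by (intro sum.cong refl sum.swap)
    also have "\<dots> = (\<Sum>t\<in>?I. \<Sum>j<?r. \<Sum>k<?r. (f j t - f k t)\<^sup>2)" by (rule sum.swap)
    also have "\<dots> = (\<Sum>t\<in>?I. 2 * (int ?r * (\<Sum>j<?r. (f j t)\<^sup>2) - (\<Sum>j<?r. f j t)\<^sup>2))"
      by (simp add: sum_sq_differences)
    also have "\<dots> = 2 * (int ?r * (\<Sum>t\<in>?I. \<Sum>j<?r. (f j t)\<^sup>2) - (\<Sum>t\<in>?I. (\<Sum>j<?r. f j t)\<^sup>2))"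
      by (simp only: sum_distrib_left[symmetric] sum_subtractf)
    also have "(\<Sum>t\<in>?I. \<Sum>j<?r. (f j t)\<^sup>2) = (\<Sum>j<?r. \<Sum>t\<in>?I. (f j t)\<^sup>2)" by (rule sum.swap)
    finally show ?thesis .
  qed
  have "4 * weight e s \<Lambda> = real_of_int (2 * (2 * (\<Sum>j<?r. ?c (s ! j))
      - (\<Sum>i\<in>?I. (?c i - ?c (i + 1))\<^sup>2)))"
    by (simp add: weight_def)
  also have "2 * (2 * (\<Sum>j<?r. ?c (s ! j)) - (\<Sum>i\<in>?I. (?c i - ?c (i + 1))\<^sup>2))
      = 4 * int ?r * W + 2 * (int ?r * E - (\<Sum>t\<in>?I. (Z t)\<^sup>2)) - 2 * (int ?r * F - (\<Sum>t\<in>?I. (G t)\<^sup>2))"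
    unfolding charges steps using squares by (simp add: algebra_simps)
  also have "\<dots> = 4 * int ?r * W + (\<Sum>j<?r. \<Sum>k<?r. \<Sum>t\<in>?I. (z j t - z k t)\<^sup>2)
      - (\<Sum>j<?r. \<Sum>k<?r. \<Sum>t\<in>?I. (?g j t - ?g k t)\<^sup>2)"
    unfolding pairs by (simp add: Z_def G_def E_def F_def)
  finally show ?thesis by (simp add: sum_subtractf)
qed

lemma reduced_multicore_weight_le:
  assumes e: "e > 0" and r: "length s > 0" and red: "is_reduced_multicore e s \<Lambda>"
  shows "weight e s \<Lambda> \<le> real e * (real (length s))\<^sup>2 / 2"
proof -
  let ?r = "length s" and ?I = "{0..<int e}" and ?g = "\<lambda>j. ground (int e) (s ! j)"
  obtain z W where z: "has_charges e s \<Lambda> z W"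
    using ex_has_charges[OF e, of s \<Lambda>] red unfolding is_reduced_multicore_def by blast
  have W: "W = 0" by (rule reduced_charges_weight_zero[OF e r red z])
  have pair: "(\<Sum>t\<in>?I. (z j t - z k t)\<^sup>2) - (\<Sum>t\<in>?I. (?g j t - ?g k t)\<^sup>2) \<le> 2 * int e"
    if "j < ?r" "k < ?r" for j k
  proof -
    have "(\<Sum>t\<in>?I. z j t - z k t) = (\<Sum>t\<in>?I. ?g j t - ?g k t)"
      using z that e by (simp add: has_charges_def sum_subtractf sum_ground)
    moreover have "\<bar>(z j t - z k t) - (z j u - z k u)\<bar> \<le> 2" if "t \<in> ?I" "u \<in> ?I" for t u
      using reduced_charges_minor_le[OF e red z \<open>j < ?r\<close> \<open>k < ?r\<close> that]
        reduced_charges_minor_le[OF e red z \<open>j < ?r\<close> \<open>k < ?r\<close> that(2,1)] by linarith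
    ultimately show ?thesis
      using sum_sq_le_of_small_differences[of ?I "\<lambda>t. z j t - z k t" "\<lambda>t. ?g j t - ?g k t"] by simp
  qed
  have "(\<Sum>j<?r. \<Sum>k<?r. (\<Sum>t\<in>?I. (z j t - z k t)\<^sup>2) - (\<Sum>t\<in>?I. (?g j t - ?g k t)\<^sup>2))
      \<le> (\<Sum>j<?r. \<Sum>k<?r. 2 * int e)"
    using pair by (intro sum_mono) auto
  then have "4 * weight e s \<Lambda> \<le> real_of_int (int ?r * (int ?r * (2 * int e)))"
    unfolding weight_charges[OF e z] W of_int_le_iff by simp
  then show ?thesis by (simp add: power2_eq_square)
qed

theorem theorem3p7:
  fixes r e :: nat
  assumes "r \<ge> 2" and "e > 0"
  shows "\<exists>C::real. C \<ge> 0 \<and>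
    (\<forall>(s :: int list) (\<Lambda> :: nat list list).
       length s = r \<longrightarrow> is_multipartition r \<Lambda> \<longrightarrow> is_reduced_multicore e s \<Lambda> \<longrightarrow>
       weight e s \<Lambda> \<le> C)"
proof (intro exI[of _ "real e * (real r)\<^sup>2 / 2"] conjI allI impI)
  fix s :: "int list" and \<Lambda> :: "nat list list"
  assume "length s = r" "is_reduced_multicore e s \<Lambda>"
  then show "weight e s \<Lambda> \<le> real e * (real r)\<^sup>2 / 2"
    using reduced_multicore_weight_le[of e s \<Lambda>] assms by simp
qed simp

end
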